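(* A solid weak BCC-algebra is branchwise implicative if and only if it is both branchwise $\varphi$-implicative and branchwise commutative.
   Context: The operation is written by juxtaposition. A weak BCC-algebra is a set $G$ with a binary operation and a constant $0$ such that for all $x,y,z\in G$: $((xy)(zy))(xz)=0$; $xx=0$; $x0=x$; and $xy=yx=0$ implies $x=y$. Its natural partial order is $x\leqslant y\iff xy=0$. $I(G)$ denotes the set of minimal elements of $(G,\leqslant)$; for $a\in I(G)$ the branch initiated by $a$ is $B(a)=\{x\in G: a\leqslant x\}$. Elements $x,y$ are in the same branch if $x,y\in B(a)$ for some $a\in I(G)$. $G$ is solid if $(xy)z=(xz)y$ for all $x,y$ belonging to the same branch and all $z\in G$. For all $x,y$ belonging to the same branch: $G$ is branchwise implicative if $x(yx)=x$; branchwise $\varphi$-implicative if $xy=(xy)\big(y(0(0y))\big)$; branchwise commutative if $x(xy)=y(yx)$. *)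

theory Defs
  imports Main
begin

locale weak_BCC_algebra =
  fixes G :: "'a set"
    and mult :: "'a \<Rightarrow> 'a \<Rightarrow> 'a"  (infixl \<open>\<cdot>\<close> 70)
    and zero :: 'a  (\<open>\<zero>\<close>)
  assumes mult_closed: "\<lbrakk>x \<in> G; y \<in> G\<rbrakk> \<Longrightarrow> x \<cdot> y \<in> G"
    and zero_closed: "\<zero> \<in> G"
    and BCC: "\<lbrakk>x \<in> G; y \<in> G; z \<in> G\<rbrakk> \<Longrightarrow> ((x \<cdot> y) \<cdot> (z \<cdot> y)) \<cdot> (x \<cdot> z) = \<zero>"
    and mult_self: "x \<in> G \<Longrightarrow> x \<cdot> x = \<zero>"
    and mult_zero: "x \<in> G \<Longrightarrow> x \<cdot> \<zero> = x"
    and mult_antisym: "\<lbrakk>x \<in> G; y \<in> G; x \<cdot> y = \<zero>; y \<cdot> x = \<zero>\<rbrakk> \<Longrightarrow> x = y"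
begin

definition le :: "'a \<Rightarrow> 'a \<Rightarrow> bool"  (infix \<open>\<preceq>\<close> 50)
  where "x \<preceq> y \<longleftrightarrow> x \<cdot> y = \<zero>"

definition minimal_elements :: "'a set"
  where "minimal_elements = {a \<in> G. \<forall>x\<in>G. x \<preceq> a \<longrightarrow> x = a}"

definition branch :: "'a \<Rightarrow> 'a set"
  where "branch a = {x \<in> G. a \<preceq> x}"

definition same_branch :: "'a \<Rightarrow> 'a \<Rightarrow> bool"
  where "same_branch x y \<longleftrightarrow> (\<exists>a\<in>minimal_elements. x \<in> branch a \<and> y \<in> branch a)"

definition solid :: bool
  where "solid \<longleftrightarrow>
    (\<forall>x\<in>G. \<forall>y\<in>G. \<forall>z\<in>G. same_branch x y \<longrightarrow> (x \<cdot> y) \<cdot> z = (x \<cdot> z) \<cdot> y)"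

definition branchwise_implicative :: bool
  where "branchwise_implicative \<longleftrightarrow>
    (\<forall>x\<in>G. \<forall>y\<in>G. same_branch x y \<longrightarrow> x \<cdot> (y \<cdot> x) = x)"

definition branchwise_phi_implicative :: bool
  where "branchwise_phi_implicative \<longleftrightarrow>
    (\<forall>x\<in>G. \<forall>y\<in>G. same_branch x y \<longrightarrow> x \<cdot> y = (x \<cdot> y) \<cdot> (y \<cdot> (\<zero> \<cdot> (\<zero> \<cdot> y))))"

definition branchwise_commutative :: bool
  where "branchwise_commutative \<longleftrightarrow>
    (\<forall>x\<in>G. \<forall>y\<in>G. same_branch x y \<longrightarrow> x \<cdot> (x \<cdot> y) = y \<cdot> (y \<cdot> x))"

end

locale solid_weak_BCC_algebra = weak_BCC_algebra +
  assumes solid: solid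

end

theory Submission
  imports Defs
begin

text \<open>
  Write \<open>\<phi> x = \<zero> \<cdot> (\<zero> \<cdot> x)\<close>. Then \<open>\<phi> x\<close> is the only minimal element below \<open>x\<close>,
  and comparable elements have the same \<open>\<phi>\<close>; so two elements lie in the same branch exactly
  when they have the same \<open>\<phi>\<close>. The product of two elements of one branch
  lies above \<open>\<zero>\<close>, and right multiplication by elements above \<open>\<zero>\<close> decreases. Now let \<open>x\<close> and
  \<open>y\<close> be in the branch of \<open>a\<close>.

  Suppose \<open>G\<close> is branchwise implicative. For \<open>\<phi>\<close>-implicativity put \<open>u = x \<cdot> y\<close> and
  \<open>v = y \<cdot> a\<close>, both in the branch of \<open>\<zero>\<close>. Solidity gives \<open>v \<cdot> u = (y \<cdot> (x \<cdot> y)) \<cdot> a = v\<close>,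
  hence \<open>u \<cdot> v = u \<cdot> (v \<cdot> u) = u\<close>. For commutativity, \<open>t = x \<cdot> (x \<cdot> y)\<close> is a
  lower bound of \<open>x\<close> and \<open>y\<close>, so \<open>t = t \<cdot> (y \<cdot> t) \<preceq> y \<cdot> (y \<cdot> t) \<preceq> y \<cdot> (y \<cdot> x)\<close>; the reverse
  inequality holds by symmetry.

  Conversely, put \<open>w = y \<cdot> x\<close> and \<open>s = x \<cdot> w\<close>, so that \<open>s \<preceq> x\<close>. By \<open>\<phi>\<close>-implicativity
  \<open>w \<cdot> (x \<cdot> a) = w\<close>, and commutativity inside the branch of \<open>\<zero>\<close> turns this into
  \<open>(x \<cdot> a) \<cdot> w = x \<cdot> a\<close>, that is, \<open>s \<cdot> a = x \<cdot> a\<close>. Therefore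
  \<open>x \<cdot> s = (x \<cdot> s) \<cdot> (s \<cdot> a) = (x \<cdot> s) \<cdot> (x \<cdot> a) = (x \<cdot> (x \<cdot> a)) \<cdot> s = a \<cdot> s = \<zero>\<close>, and \<open>s = x\<close>.
\<close>

context weak_BCC_algebra
begin

lemma le_antisym: "\<lbrakk>x \<in> G; y \<in> G; x \<preceq> y; y \<preceq> x\<rbrakk> \<Longrightarrow> x = y"
  by (simp add: le_def mult_antisym)

lemma mult_right_mono:
  assumes "x \<in> G" "y \<in> G" "z \<in> G" "x \<preceq> y"
  shows "x \<cdot> z \<preceq> y \<cdot> z"
  using BCC[of x z y] assms by (simp add: le_def mult_zero mult_closed)

lemma mult_left_antimono:
  assumes "x \<in> G" "y \<in> G" "z \<in> G" "x \<preceq> y"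
  shows "z \<cdot> y \<preceq> z \<cdot> x"
  using BCC[of z y x] assms by (simp add: le_def mult_zero mult_closed)

lemma le_trans:
  assumes "x \<in> G" "y \<in> G" "z \<in> G" "x \<preceq> y" "y \<preceq> z"
  shows "x \<preceq> z"
  using mult_right_mono[of x y z] assms by (simp add: le_def mult_zero mult_closed)

lemma phi_le_of_le:
  assumes "x \<in> G" "y \<in> G" "x \<preceq> y"
  shows "\<zero> \<cdot> (\<zero> \<cdot> y) \<preceq> x"
  using BCC[of x y \<zero>] assms by (simp add: le_def mult_zero zero_closed)

lemma phi_le: "x \<in> G \<Longrightarrow> \<zero> \<cdot> (\<zero> \<cdot> x) \<preceq> x"
  using phi_le_of_le[of x x] by (simp add: le_def mult_self)

lemma zero_mult_phi:
  assumes "x \<in> G"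
  shows "\<zero> \<cdot> (\<zero> \<cdot> (\<zero> \<cdot> x)) = \<zero> \<cdot> x"
  using assms phi_le[of "\<zero> \<cdot> x"] mult_left_antimono[OF _ _ _ phi_le[OF assms], of \<zero>]
  by (intro le_antisym) (simp_all add: mult_closed zero_closed)

lemma zero_mult_eq_of_le:
  assumes "x \<in> G" "y \<in> G" "x \<preceq> y"
  shows "\<zero> \<cdot> x = \<zero> \<cdot> y"
proof (rule le_antisym)
  have "\<zero> \<cdot> x \<preceq> \<zero> \<cdot> (\<zero> \<cdot> (\<zero> \<cdot> y))"
    using phi_le_of_le[OF assms] assms by (intro mult_left_antimono) (simp_all add: mult_closed zero_closed)
  then show "\<zero> \<cdot> x \<preceq> \<zero> \<cdot> y"
    using assms by (simp add: zero_mult_phi)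
  show "\<zero> \<cdot> y \<preceq> \<zero> \<cdot> x"
    using assms by (intro mult_left_antimono) (simp_all add: zero_closed)
qed (use assms in \<open>simp_all add: mult_closed zero_closed\<close>)

lemma phi_minimal:
  assumes "x \<in> G"
  shows "\<zero> \<cdot> (\<zero> \<cdot> x) \<in> minimal_elements"
proof -
  have "y = \<zero> \<cdot> (\<zero> \<cdot> x)" if y: "y \<in> G" "y \<preceq> \<zero> \<cdot> (\<zero> \<cdot> x)" for y
  proof (rule le_antisym)
    have "\<zero> \<cdot> y = \<zero> \<cdot> x"
      using zero_mult_eq_of_le[of y "\<zero> \<cdot> (\<zero> \<cdot> x)"] y assms
      by (simp add: zero_mult_phi mult_closed zero_closed)
    then show "\<zero> \<cdot> (\<zero> \<cdot> x) \<preceq> y"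
      using phi_le[OF y(1)] by simp
  qed (use y assms in \<open>simp_all add: mult_closed zero_closed\<close>)
  then show ?thesis
    using assms by (auto simp: minimal_elements_def mult_closed zero_closed)
qed

text \<open>Since \<open>\<zero> \<cdot> (\<zero> \<cdot> (\<zero> \<cdot> x)) = \<zero> \<cdot> x\<close>, the branch of \<open>x\<close> is already determined by \<open>\<zero> \<cdot> x\<close>.\<close>

lemma same_branch_iff:
  assumes "x \<in> G" "y \<in> G"
  shows "same_branch x y \<longleftrightarrow> \<zero> \<cdot> x = \<zero> \<cdot> y"
proof
  assume "same_branch x y"
  then obtain a where "a \<in> G" "a \<preceq> x" "a \<preceq> y"
    by (auto simp: same_branch_def branch_def minimal_elements_def)
  then show "\<zero> \<cdot> x = \<zero> \<cdot> y"
    using zero_mult_eq_of_le[of a] assms by metis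
next
  assume "\<zero> \<cdot> x = \<zero> \<cdot> y"
  then have "x \<in> branch (\<zero> \<cdot> (\<zero> \<cdot> x))" "y \<in> branch (\<zero> \<cdot> (\<zero> \<cdot> x))"
    using phi_le[OF assms(1)] phi_le[OF assms(2)] assms by (simp_all add: branch_def)
  then show "same_branch x y"
    using phi_minimal[OF assms(1)] by (auto simp: same_branch_def)
qed

lemma zero_mult_mult_eq_zero:
  assumes "x \<in> G" "y \<in> G" "\<zero> \<cdot> x = \<zero> \<cdot> y"
  shows "\<zero> \<cdot> (x \<cdot> y) = \<zero>"
proof -
  have "\<zero> \<cdot> (\<zero> \<cdot> x) \<cdot> y \<preceq> x \<cdot> y"
    using assms phi_le[OF assms(1)]
    by (intro mult_right_mono) (simp_all only: mult_closed zero_closed)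
  moreover have "\<zero> \<cdot> (\<zero> \<cdot> x) \<cdot> y = \<zero>"
    using phi_le[OF assms(2)] assms(3) by (simp add: le_def)
  ultimately show ?thesis by (simp add: le_def)
qed

lemma mult_le_left:
  assumes "x \<in> G" "z \<in> G" "\<zero> \<cdot> z = \<zero>"
  shows "x \<cdot> z \<preceq> x"
  using mult_left_antimono[of \<zero> z x] assms by (simp add: le_def mult_zero zero_closed)

end

context solid_weak_BCC_algebra
begin

lemma mult_right_commute:
  assumes "x \<in> G" "y \<in> G" "z \<in> G" "\<zero> \<cdot> x = \<zero> \<cdot> y"
  shows "x \<cdot> y \<cdot> z = x \<cdot> z \<cdot> y"
  using solid assms same_branch_iff[of x y] unfolding solid_def by blast

lemma mult_mult_le:
  assumes "x \<in> G" "y \<in> G" "\<zero> \<cdot> x = \<zero> \<cdot> y"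
  shows "x \<cdot> (x \<cdot> y) \<preceq> y"
proof -
  have "x \<cdot> (x \<cdot> y) \<cdot> y = x \<cdot> y \<cdot> (x \<cdot> y)"
    using assms by (intro mult_right_commute[symmetric]) (simp_all only: mult_closed)
  also have "\<dots> = \<zero>"
    using assms by (intro mult_self mult_closed)
  finally show ?thesis by (simp add: le_def)
qed

lemma phi_implicative_if_implicative:
  assumes branchwise_implicative
  shows branchwise_phi_implicative
  unfolding branchwise_phi_implicative_def
proof (intro ballI impI)
  fix x y assume G: "x \<in> G" "y \<in> G" and "same_branch x y"
  then have xy: "\<zero> \<cdot> x = \<zero> \<cdot> y" by (simp add: same_branch_iff)
  have impl: "p \<cdot> (q \<cdot> p) = p" if "p \<in> G" "q \<in> G" "\<zero> \<cdot> p = \<zero> \<cdot> q" for p q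
    using assms that by (simp add: branchwise_implicative_def same_branch_iff)
  define a u v where "a = \<zero> \<cdot> (\<zero> \<cdot> y)" and "u = x \<cdot> y" and "v = y \<cdot> a"
  have a: "a \<in> G" "\<zero> \<cdot> y = \<zero> \<cdot> a"
    using G by (simp_all add: a_def mult_closed zero_closed zero_mult_phi)
  have uv: "u \<in> G" "v \<in> G" "\<zero> \<cdot> u = \<zero>" "\<zero> \<cdot> v = \<zero>"
    using G a xy zero_mult_mult_eq_zero[of x y] zero_mult_mult_eq_zero[of y a]
    by (simp_all add: u_def v_def mult_closed)
  have "v \<cdot> u = y \<cdot> u \<cdot> a"
    unfolding v_def using G a uv by (intro mult_right_commute)
  also have "\<dots> = v"
    using impl[of y x] G xy by (simp add: u_def v_def)
  finally have "u \<cdot> v = u"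
    using impl[of u v] uv by simp
  then show "x \<cdot> y = x \<cdot> y \<cdot> (y \<cdot> (\<zero> \<cdot> (\<zero> \<cdot> y)))"
    by (simp add: a_def u_def v_def)
qed

lemma commutative_if_implicative:
  assumes branchwise_implicative
  shows branchwise_commutative
proof -
  have half: "x \<cdot> (x \<cdot> y) \<preceq> y \<cdot> (y \<cdot> x)"
    if G: "x \<in> G" "y \<in> G" and xy: "\<zero> \<cdot> x = \<zero> \<cdot> y" for x y
  proof -
    define t where "t = x \<cdot> (x \<cdot> y)"
    have t: "t \<in> G" "t \<preceq> x" "t \<preceq> y"
      using G xy mult_le_left[of x "x \<cdot> y"]
      by (simp_all add: t_def mult_closed mult_mult_le zero_mult_mult_eq_zero)
    have "\<zero> \<cdot> t = \<zero> \<cdot> y"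
      using t(1) G(2) t(3) by (rule zero_mult_eq_of_le)
    then have "t \<cdot> (y \<cdot> t) = t"
      using assms t G by (simp add: branchwise_implicative_def same_branch_iff)
    moreover have "t \<cdot> (y \<cdot> t) \<preceq> y \<cdot> (y \<cdot> t)"
      using t G by (intro mult_right_mono) (simp_all add: mult_closed)
    moreover have "y \<cdot> (y \<cdot> t) \<preceq> y \<cdot> (y \<cdot> x)"
      using t G by (intro mult_left_antimono) (simp_all add: mult_closed)
    ultimately have "t \<preceq> y \<cdot> (y \<cdot> x)"
      using le_trans[of t "y \<cdot> (y \<cdot> t)" "y \<cdot> (y \<cdot> x)"] t G by (simp add: mult_closed)
    then show ?thesis by (simp add: t_def)
  qed
  show ?thesis
    unfolding branchwise_commutative_def
    using half by (simp add: same_branch_iff le_antisym mult_closed)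
qed

lemma implicative_if_phi_implicative_commutative:
  assumes branchwise_phi_implicative branchwise_commutative
  shows branchwise_implicative
  unfolding branchwise_implicative_def
proof (intro ballI impI)
  fix x y assume G: "x \<in> G" "y \<in> G" and "same_branch x y"
  then have xy: "\<zero> \<cdot> x = \<zero> \<cdot> y" by (simp add: same_branch_iff)
  have phi: "p \<cdot> q \<cdot> (q \<cdot> (\<zero> \<cdot> (\<zero> \<cdot> q))) = p \<cdot> q"
    if "p \<in> G" "q \<in> G" "\<zero> \<cdot> p = \<zero> \<cdot> q" for p q
    using assms(1) that by (simp add: branchwise_phi_implicative_def same_branch_iff)
  have comm: "p \<cdot> (p \<cdot> q) = q \<cdot> (q \<cdot> p)"
    if "p \<in> G" "q \<in> G" "\<zero> \<cdot> p = \<zero> \<cdot> q" for p q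
    using assms(2) that by (simp add: branchwise_commutative_def same_branch_iff)
  define a u w s where "a = \<zero> \<cdot> (\<zero> \<cdot> x)" and "u = x \<cdot> a" and "w = y \<cdot> x" and "s = x \<cdot> w"
  have a: "a \<in> G" "\<zero> \<cdot> x = \<zero> \<cdot> a" "a \<cdot> x = \<zero>"
    using G phi_le[of x] by (simp_all add: a_def mult_closed zero_closed zero_mult_phi le_def)
  have uw: "u \<in> G" "w \<in> G" "\<zero> \<cdot> u = \<zero>" "\<zero> \<cdot> w = \<zero>"
    using G a xy zero_mult_mult_eq_zero[of x a] zero_mult_mult_eq_zero[of y x]
    by (simp_all add: u_def w_def mult_closed)
  have s: "s \<in> G" "s \<preceq> x"
    using G uw mult_le_left[of x w] by (simp_all add: s_def mult_closed)
  have xs: "\<zero> \<cdot> x = \<zero> \<cdot> s"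
    using s G by (simp add: zero_mult_eq_of_le)
  have "w \<cdot> u = w"
    using phi[of y x] G xy by (simp add: u_def w_def a_def)
  then have "u \<preceq> u \<cdot> w"
    using comm[of u w] uw by (simp add: le_def mult_self)
  then have "u \<cdot> w = u"
    using uw mult_le_left[of u w] by (intro le_antisym) (simp_all add: mult_closed)
  then have sa: "s \<cdot> a = u"
    using mult_right_commute[of x a w] G a uw by (simp add: u_def s_def)
  have "x \<cdot> s = x \<cdot> s \<cdot> (s \<cdot> a)"
    using phi[of x s] G s xs by (simp add: a_def)
  also have "\<dots> = x \<cdot> u \<cdot> s"
    unfolding sa using G s xs uw by (intro mult_right_commute)
  also have "x \<cdot> u = a"
    using comm[of x a] G a by (simp add: u_def mult_zero)
  also have "a \<cdot> s = \<zero>"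
    using phi_le[of s] s xs by (simp add: a_def le_def)
  finally have "s = x"
    using s G by (intro le_antisym) (simp_all add: le_def)
  then show "x \<cdot> (y \<cdot> x) = x" by (simp add: s_def w_def)
qed

end

theorem theorem6p7:
  fixes G :: "'a set" and mult :: "'a \<Rightarrow> 'a \<Rightarrow> 'a" and zero :: 'a
  assumes "solid_weak_BCC_algebra G mult zero"
  shows "weak_BCC_algebra.branchwise_implicative G mult zero \<longleftrightarrow>
    weak_BCC_algebra.branchwise_phi_implicative G mult zero \<and>
    weak_BCC_algebra.branchwise_commutative G mult zero"
proof -
  interpret solid_weak_BCC_algebra G mult zero by (fact assms)
  show ?thesis
    using phi_implicative_if_implicative commutative_if_implicative
      implicative_if_phi_implicative_commutative by blast
qed

end
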